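(* Let $A$ be a finite set of $k \ge 3$ alternatives, let $n \ge 1$, and let $F$ be a constitution on $A$ with $n$ voters. If $F$ satisfies Transitivity, Independence of Irrelevant Alternatives (IIA) and Weak Non-Imposition (WNI), then $F$ is a dictatorship; that is, there exists a voter $i \in \{1,\dots,n\}$ such that either $F(\sigma) = \sigma(i)$ for all profiles $\sigma$, or $F(\sigma) = -\sigma(i)$ for all profiles $\sigma$.
   Context: A (strict) transitive preference over a finite set $A$ of alternatives is a strict linear ranking of the elements of $A$ (no ties). There are $n$ voters $1,\dots,n$; a profile is an $n$-tuple $\sigma = (\sigma(1),\dots,\sigma(n))$ of strict rankings of $A$ (all such $n$-tuples are allowed), $\sigma(i)$ being the ranking of voter $i$. A constitution is a function $F$ that associates to every profile $\sigma$ and every pair of distinct alternatives $a,b$ a strict preference between $a$ and $b$ (exactly one of "$F(\sigma)$ ranks $a$ above $b$" and "$F(\sigma)$ ranks $b$ above $a$" holds); $F(\sigma)$ denotes the resulting collection of pairwise preferences, which is not assumed a priori to be transitive. Transitivity: for every profile $\sigma$ and all three distinct alternatives $a,b,c$, if $F(\sigma)$ ranks $a$ above $b$ and $b$ above $c$, then it ranks $a$ above $c$. IIA: for every pair of alternatives $a,b$, the preference of $F(\sigma)$ between $a$ and $b$ depends only on the relative rankings of $a$ and $b$ by the voters in $\sigma$. WNI: for every ordered pair of distinct alternatives $(a,b)$ there exists a profile $\sigma$ such that $F(\sigma)$ ranks $a$ above $b$. For a ranking $\tau$, $-\tau$ denotes the reversed ranking. An equality such as $F(\sigma)=\tau$ means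 that the pairwise preferences of $F(\sigma)$ are exactly those of the ranking $\tau$. *)

theory Defs
  imports Main "HOL-Library.FuncSet"
begin

text \<open>Preferences are relations read as: \<open>(a, b) \<in> r\<close> iff \<open>r\<close> ranks \<open>a\<close> above \<open>b\<close>.
  The library's \<^const>\<open>strict_linear_order_on\<close> does not confine the relation to the carrier,
  hence the additional inclusion.\<close>

definition rankings :: "'a set \<Rightarrow> 'a rel set" where
  "rankings A = {r. r \<subseteq> A \<times> A \<and> strict_linear_order_on A r}"

text \<open>Voters are \<open>1, \<dots>, n\<close>. The functions are extensional, so that an element is determined
  by the \<open>n\<close>-tuple of rankings.\<close>

definition profiles :: "nat \<Rightarrow> 'a set \<Rightarrow> (nat \<Rightarrow> 'a rel) set" where
  "profiles n A = ({1..n} \<rightarrow>\<^sub>E rankings A)"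

text \<open>\<open>F \<sigma>\<close> only contains pairs of distinct alternatives, so that \<open>F \<sigma> = \<tau>\<close> for a ranking \<open>\<tau>\<close>
  means equality of all pairwise preferences.\<close>

definition constitution :: "nat \<Rightarrow> 'a set \<Rightarrow> ((nat \<Rightarrow> 'a rel) \<Rightarrow> 'a rel) \<Rightarrow> bool" where
  "constitution n A F \<longleftrightarrow>
    (\<forall>\<sigma>\<in>profiles n A. F \<sigma> \<subseteq> A \<times> A \<and> irrefl (F \<sigma>) \<and>
      (\<forall>a\<in>A. \<forall>b\<in>A. a \<noteq> b \<longrightarrow> ((a, b) \<in> F \<sigma> \<longleftrightarrow> (b, a) \<notin> F \<sigma>)))"

definition transitivity :: "nat \<Rightarrow> 'a set \<Rightarrow> ((nat \<Rightarrow> 'a rel) \<Rightarrow> 'a rel) \<Rightarrow> bool" where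
  "transitivity n A F \<longleftrightarrow>
    (\<forall>\<sigma>\<in>profiles n A. \<forall>a\<in>A. \<forall>b\<in>A. \<forall>c\<in>A.
      a \<noteq> b \<and> b \<noteq> c \<and> a \<noteq> c \<longrightarrow> (a, b) \<in> F \<sigma> \<longrightarrow> (b, c) \<in> F \<sigma> \<longrightarrow> (a, c) \<in> F \<sigma>)"

definition IIA :: "nat \<Rightarrow> 'a set \<Rightarrow> ((nat \<Rightarrow> 'a rel) \<Rightarrow> 'a rel) \<Rightarrow> bool" where
  "IIA n A F \<longleftrightarrow>
    (\<forall>a\<in>A. \<forall>b\<in>A. a \<noteq> b \<longrightarrow>
      (\<forall>\<sigma>\<in>profiles n A. \<forall>\<sigma>'\<in>profiles n A.
        (\<forall>i\<in>{1..n}. (a, b) \<in> \<sigma> i \<longleftrightarrow> (a, b) \<in> \<sigma>' i) \<longrightarrow>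
        ((a, b) \<in> F \<sigma> \<longleftrightarrow> (a, b) \<in> F \<sigma>')))"

definition WNI :: "nat \<Rightarrow> 'a set \<Rightarrow> ((nat \<Rightarrow> 'a rel) \<Rightarrow> 'a rel) \<Rightarrow> bool" where
  "WNI n A F \<longleftrightarrow>
    (\<forall>a\<in>A. \<forall>b\<in>A. a \<noteq> b \<longrightarrow> (\<exists>\<sigma>\<in>profiles n A. (a, b) \<in> F \<sigma>))"

end

theory Submission
  imports Defs
begin

text \<open>By IIA, the preference of \<open>F\<close> between \<open>a\<close> and \<open>b\<close> is a Boolean function \<open>w a b\<close> of the set
  of voters ranking \<open>a\<close> above \<open>b\<close>. Voter sets \<open>S\<close>, \<open>T\<close>, \<open>U\<close> occur together as the supporters of
  \<open>a > b\<close>, \<open>b > c\<close>, \<open>a > c\<close> iff \<open>S \<inter> T \<subseteq> U \<subseteq> S \<union> T\<close>, so transitivity says that \<open>w a b S\<close> and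
  \<open>w b c T\<close> imply \<open>w a c U\<close> for these \<open>U\<close>. If \<open>S\<close> and \<open>T\<close> are the empty set and the set of all
  voters, \<open>U\<close> is arbitrary, which contradicts WNI; hence unanimity is either respected for all
  pairs or reversed for all pairs, and up to reversal it is respected. Then \<open>w a b\<close> does not depend
  on \<open>a\<close> and \<open>b\<close>, and it is an ultrafilter on the finite set of voters, hence principal. The voter
  generating it is the dictator.\<close>

section \<open>Abstract winning voter sets and unanimity\<close>

locale decisive_sets =
  fixes A :: "'a set" and N :: "'v set" and w :: "'a \<Rightarrow> 'a \<Rightarrow> 'v set \<Rightarrow> bool"
  assumes finite_voters: "finite N"
    and third: "\<And>a b. \<exists>c\<in>A. c \<noteq> a \<and> c \<noteq> b"
    and compl: "\<lbrakk>a \<in> A; b \<in> A; a \<noteq> b; S \<subseteq> N\<rbrakk> \<Longrightarrow> w b a (N - S) \<longleftrightarrow> \<not> w a b S"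
    and trans: "\<lbrakk>a \<in> A; b \<in> A; c \<in> A; a \<noteq> b; b \<noteq> c; a \<noteq> c; S \<subseteq> N; T \<subseteq> N;
      w a b S; w b c T; S \<inter> T \<subseteq> U; U \<subseteq> S \<union> T\<rbrakk> \<Longrightarrow> w a c U"
    and non_imposed: "\<lbrakk>a \<in> A; b \<in> A; a \<noteq> b\<rbrakk> \<Longrightarrow> \<exists>S\<subseteq>N. w a b S"
begin

lemma compl_all:
  assumes "a \<in> A" "b \<in> A" "a \<noteq> b"
  shows "w b a {} \<longleftrightarrow> \<not> w a b N" "w b a N \<longleftrightarrow> \<not> w a b {}"
  using compl[OF assms, of N] compl[OF assms, of "{}"] by auto

text \<open>\<open>non_imposed\<close> only rules out the constantly false function; for the
  reversed pair it rules out, through \<open>compl\<close>, the constantly true one.\<close>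

lemma not_constant:
  assumes "a \<in> A" "b \<in> A" "a \<noteq> b"
  obtains S where "S \<subseteq> N" "\<not> w a b S"
proof -
  obtain T where "T \<subseteq> N" "w b a T"
    using non_imposed[of b a] assms by auto
  then show ?thesis
    using that[of "N - T"] compl[of b a T] assms by auto
qed

text \<open>Here \<open>S \<inter> T\<close> is empty and \<open>S \<union> T\<close> is
  \<open>N\<close>, so \<open>trans\<close> would make \<open>w a c\<close> hold on every voter
  set.\<close>

lemma not_full_empty:
  assumes "a \<in> A" "b \<in> A" "c \<in> A" "a \<noteq> b" "b \<noteq> c" "a \<noteq> c"
  shows "\<not> (w a b N \<and> w b c {})" "\<not> (w a b {} \<and> w b c N)"
proof -
  obtain U where "U \<subseteq> N" "\<not> w a c U"
    using not_constant[of a c] assms by auto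
  then show "\<not> (w a b N \<and> w b c {})" "\<not> (w a b {} \<and> w b c N)"
    using trans[of a b c N "{}" U] trans[of a b c "{}" N U] assms by auto
qed

lemma full_iff_not_empty:
  assumes ab: "a \<in> A" "b \<in> A" "a \<noteq> b"
  shows "w a b N \<longleftrightarrow> \<not> w a b {}"
proof -
  \<comment> \<open>If \<open>w x y\<close> held on both sets, joining it with sets winning
    \<open>y\<close> over \<open>z\<close> and \<open>z\<close> over \<open>x\<close> would give
    \<open>w x z N\<close> and \<open>w z y {}\<close>, which \<open>not_full_empty\<close>
    forbids.\<close>
  have imp: "\<not> (w x y N \<and> w x y {})" if xy: "x \<in> A" "y \<in> A" "x \<noteq> y" for x y
  proof
    assume both: "w x y N \<and> w x y {}"
    obtain z where z: "z \<in> A" "z \<noteq> x" "z \<noteq> y"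
      using third by blast
    obtain T where "T \<subseteq> N" "w y z T"
      using non_imposed[of y z] xy z by auto
    then have xz: "w x z N" "w x z {}"
      using trans[of x y z N T N] trans[of x y z "{}" T "{}"] both xy z by auto
    obtain S where "S \<subseteq> N" "w z x S"
      using non_imposed[of z x] xy z by auto
    then have "w z y {}"
      using trans[of z x y S "{}" "{}"] both xy z by auto
    then show False
      using not_full_empty(1)[of x z y] xz xy z by auto
  qed
  \<comment> \<open>By complement, failure of \<open>w a b\<close> on both sets is success of
    \<open>w b a\<close> on both.\<close>
  from imp[of a b] imp[of b a] show ?thesis
    using compl_all[of a b] ab by auto
qed

text \<open>Any ordered pair is reached from any other by changing one entry at a time.\<close>

lemma all_pairs:
  assumes "P a b" and xy: "a \<in> A" "b \<in> A" "a \<noteq> b" "x \<in> A" "y \<in> A" "x \<noteq> y"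
    and right: "\<And>a b c. \<lbrakk>a \<in> A; b \<in> A; c \<in> A; a \<noteq> b; b \<noteq> c; a \<noteq> c; P a b\<rbrakk> \<Longrightarrow> P a c"
    and left: "\<And>a b c. \<lbrakk>a \<in> A; b \<in> A; c \<in> A; a \<noteq> b; b \<noteq> c; a \<noteq> c; P b c\<rbrakk> \<Longrightarrow> P a c"
  shows "P x y"
proof (cases "y = a")
  case False
  then have "P a y"
    using assms(1) right[of a b y] xy by (cases "y = b") auto
  then show ?thesis
    using left[of x a y] False xy by (cases "x = a") auto
next
  case True
  \<comment> \<open>The direct route would pass through \<open>(a, a)\<close>; the detour is
    \<open>(a, b)\<close>, \<open>(a, z)\<close>, \<open>(x, z)\<close>,
    \<open>(x, a)\<close>.\<close>
  obtain z where z: "z \<in> A" "z \<noteq> a" "z \<noteq> x"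
    using third by blast
  have "P a z"
    using assms(1) right[of a b z] xy z by (cases "z = b") auto
  then have "P x z"
    using left[of x a z] True xy z by auto
  then show ?thesis
    using right[of x z y] True xy z by auto
qed

text \<open>By \<open>not_full_empty\<close> the pair adjoining the given one in a chain is not won
  by the empty set, so \<open>full_iff_not_empty\<close> makes \<open>N\<close> win it, and
  \<open>trans\<close> composes the two.\<close>

lemma full_all_pairs:
  assumes "w a b N" "a \<in> A" "b \<in> A" "a \<noteq> b" "x \<in> A" "y \<in> A" "x \<noteq> y"
  shows "w x y N"
proof (rule all_pairs[where P = "\<lambda>a b. w a b N", OF assms])
  fix a b c assume abc: "a \<in> A" "b \<in> A" "c \<in> A" "a \<noteq> b" "b \<noteq> c" "a \<noteq> c"
  show "w a c N" if "w a b N"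
  proof -
    have "w b c N"
      using that not_full_empty(1)[of a b c] full_iff_not_empty[of b c] abc by auto
    then show ?thesis
      using trans[of a b c N N N] that abc by auto
  qed
  show "w a c N" if "w b c N"
  proof -
    have "w a b N"
      using that not_full_empty(2)[of a b c] full_iff_not_empty[of a b] abc by auto
    then show ?thesis
      using trans[of a b c N N N] that abc by auto
  qed
qed

section \<open>Neutrality, the ultrafilter and reversal\<close>

lemma unanimous_dictator:
  assumes full: "\<And>a b. \<lbrakk>a \<in> A; b \<in> A; a \<noteq> b\<rbrakk> \<Longrightarrow> w a b N"
  shows "\<exists>i\<in>N. \<forall>a\<in>A. \<forall>b\<in>A. a \<noteq> b \<longrightarrow> (\<forall>S\<subseteq>N. w a b S \<longleftrightarrow> i \<in> S)"
proof -
  \<comment> \<open>Composing with a pair won by \<open>N\<close>, on either side, permits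
    \<open>U = S\<close>, so \<open>S\<close> also wins the new pair.\<close>
  have neutral: "w x y S"
    if S: "S \<subseteq> N" "w a b S" and xy: "a \<in> A" "b \<in> A" "a \<noteq> b" "x \<in> A" "y \<in> A" "x \<noteq> y"
    for a b x y S
  proof (rule all_pairs[where P = "\<lambda>a b. w a b S", OF S(2) xy])
    fix a b c assume abc: "a \<in> A" "b \<in> A" "c \<in> A" "a \<noteq> b" "b \<noteq> c" "a \<noteq> c"
    show "w a c S" if "w a b S"
      using trans[of a b c S N S] that abc full S(1) by auto
    show "w a c S" if "w b c S"
      using trans[of a b c N S S] that abc full S(1) by auto
  qed
  obtain p where p: "p \<in> A"
    using third by blast
  obtain q where q: "q \<in> A" "p \<noteq> q"
    using third[of p] by blast
  obtain r where r: "r \<in> A" "r \<noteq> p" "r \<noteq> q"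
    using third by blast
  let ?D = "{S. S \<subseteq> N \<and> w p q S}"
  have D: "w a b S \<longleftrightarrow> S \<in> ?D" if "a \<in> A" "b \<in> A" "a \<noteq> b" "S \<subseteq> N" for a b S
    using neutral[of S a b p q] neutral[of S p q a b] that p q by auto
  \<comment> \<open>Composing with a unanimous pair permits every \<open>U\<close> between
    \<open>S\<close> and \<open>N\<close>; for \<open>int\<close>, \<open>S \<inter> T\<close> is
    the least permitted \<open>U\<close>.\<close>
  have up: "U \<in> ?D" if "S \<in> ?D" "S \<subseteq> U" "U \<subseteq> N" for S U
    using trans[of p q r S N U] D[of p r U] full[of q r] that p q r by auto
  have int: "S \<inter> T \<in> ?D" if "S \<in> ?D" "T \<in> ?D" for S T
    using trans[of p q r S T "S \<inter> T"] D[of p r "S \<inter> T"] D[of q r T] that p q r by auto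
  have ultra: "N - S \<in> ?D \<longleftrightarrow> S \<notin> ?D" if "S \<subseteq> N" for S
    using compl[of p q S] D[of q p "N - S"] that p q by auto
  have N: "N \<in> ?D"
    using full p q by auto
  \<comment> \<open>The family is taken nonempty because the empty intersection is
    \<open>UNIV\<close>.\<close>
  have "\<Inter>X \<in> ?D" if "finite X" "X \<noteq> {}" "X \<subseteq> ?D" for X
    using that
  proof (induction X rule: finite_ne_induct)
    case (insert S X)
    then show ?case
      using int[of S "\<Inter>X"] by simp
  qed simp
  moreover have "finite ?D"
    using finite_voters by auto
  ultimately have I: "\<Inter>?D \<in> ?D"
    using N by blast
  then have "\<Inter>?D \<noteq> {}"
    using ultra[of N] N by auto
  then obtain i where i: "i \<in> \<Inter>?D"
    by blast
  \<comment> \<open>If \<open>S\<close> is not in \<open>?D\<close>, then \<open>N - S\<close> is,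
    so \<open>i\<close> lies in \<open>N - S\<close> and not in \<open>S\<close>.\<close>
  have "S \<in> ?D \<longleftrightarrow> i \<in> S" if "S \<subseteq> N" for S
    using i ultra[OF that] by blast
  then show ?thesis
    using D i N by (intro bexI[of _ i]) auto
qed

text \<open>By \<open>compl\<close>, negating \<open>w\<close> amounts to reversing the pair and
  complementing the voter set; De Morgan carries the bounds on \<open>U\<close> over to the chain
  \<open>c\<close>, \<open>b\<close>, \<open>a\<close>.\<close>

lemma decisive_sets_dual: "decisive_sets A N (\<lambda>a b S. \<not> w a b S)"
proof
  fix a b c S T U
  assume abc: "a \<in> A" "b \<in> A" "c \<in> A" "a \<noteq> b" "b \<noteq> c" "a \<noteq> c"
    and "S \<subseteq> N" "T \<subseteq> N" "\<not> w a b S" "\<not> w b c T" "S \<inter> T \<subseteq> U" "U \<subseteq> S \<union> T"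
  moreover from this have "U \<subseteq> N"
    by blast
  ultimately show "\<not> w a c U"
    using trans[of c b a "N - T" "N - S" "N - U"] compl[of a b S] compl[of b c T] compl[of a c U]
    by auto
next
  fix a b assume "a \<in> A" "b \<in> A" "a \<noteq> b"
  then show "\<exists>S\<subseteq>N. \<not> w a b S"
    using not_constant by metis
next
  show "finite N"
    by (rule finite_voters)
next
  show "\<exists>c\<in>A. c \<noteq> a \<and> c \<noteq> b" for a b
    by (rule third)
next
  fix a b S assume "a \<in> A" "b \<in> A" "a \<noteq> b" "S \<subseteq> N"
  then show "\<not> w b a (N - S) \<longleftrightarrow> \<not> \<not> w a b S"
    using compl by blast
qed

lemma dictator:
  "\<exists>i\<in>N. (\<forall>a\<in>A. \<forall>b\<in>A. a \<noteq> b \<longrightarrow> (\<forall>S\<subseteq>N. w a b S \<longleftrightarrow> i \<in> S)) \<or>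
    (\<forall>a\<in>A. \<forall>b\<in>A. a \<noteq> b \<longrightarrow> (\<forall>S\<subseteq>N. w a b S \<longleftrightarrow> i \<notin> S))"
proof (cases "\<forall>a\<in>A. \<forall>b\<in>A. a \<noteq> b \<longrightarrow> w a b N")
  case True
  then have "w a b N" if "a \<in> A" "b \<in> A" "a \<noteq> b" for a b
    using that by blast
  from unanimous_dictator[OF this] show ?thesis
    by blast
next
  case False
  interpret dual: decisive_sets A N "\<lambda>a b S. \<not> w a b S"
    by (rule decisive_sets_dual)
  \<comment> \<open>If unanimity fails for one pair, it fails for all, which is unanimity for the
    dual.\<close>
  have "\<not> w a b N" if "a \<in> A" "b \<in> A" "a \<noteq> b" for a b
    using False full_all_pairs that by blast
  from dual.unanimous_dictator[OF this] obtain i where "i \<in> N"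
    and i: "\<forall>a\<in>A. \<forall>b\<in>A. a \<noteq> b \<longrightarrow> (\<forall>S\<subseteq>N. \<not> w a b S \<longleftrightarrow> i \<in> S)"
    by (rule bexE)
  have "w a b S \<longleftrightarrow> i \<notin> S" if "a \<in> A" "b \<in> A" "a \<noteq> b" "S \<subseteq> N" for a b S
    using i that by blast
  with \<open>i \<in> N\<close> show ?thesis
    by (intro bexI[of _ i] disjI2) auto
qed

end

section \<open>Rankings with prescribed comparisons\<close>

lemma ranking_of_inj:
  fixes f :: "'a \<Rightarrow> nat"
  assumes "inj_on f A"
  shows "{(x, y) \<in> A \<times> A. f x < f y} \<in> rankings A"
proof -
  have "f x < f y \<or> f y < f x" if "x \<in> A" "y \<in> A" "x \<noteq> y" for x y
    using inj_onD[OF assms, of x y] that by linarith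
  then show ?thesis
    by (auto simp: rankings_def strict_linear_order_on_def trans_def irrefl_def total_on_def)
qed

lemma ranking_asym: "r \<in> rankings A \<Longrightarrow> (x, y) \<in> r \<Longrightarrow> (y, x) \<notin> r"
  unfolding rankings_def strict_linear_order_on_def trans_def irrefl_def by blast

lemma ranking_total:
  "\<lbrakk>r \<in> rankings A; x \<in> A; y \<in> A; x \<noteq> y\<rbrakk> \<Longrightarrow> (y, x) \<in> r \<longleftrightarrow> (x, y) \<notin> r"
  using ranking_asym[of r A x y]
  by (auto simp: rankings_def strict_linear_order_on_def total_on_def)

lemma ranking_extends:
  assumes "finite A" "x \<in> A" "y \<in> A" "z \<in> A" "x \<noteq> y" "y \<noteq> z" "x \<noteq> z"
  shows "\<exists>r\<in>rankings A. (x, y) \<in> r \<and> (y, z) \<in> r \<and> (x, z) \<in> r"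
proof -
  obtain g :: "'a \<Rightarrow> nat" where g: "inj_on g A"
    using finite_imp_inj_to_nat_seg[OF assms(1)] by auto
  \<comment> \<open>Smaller values rank higher; the shift by 3 frees 0, 1, 2 for the three given
    alternatives.\<close>
  let ?f = "(\<lambda>v. g v + 3)(x := 0, y := 1, z := 2)"
  have "inj_on ?f A"
    using g by (auto simp: inj_on_def)
  from ranking_of_inj[OF this] show ?thesis
    using assms by (intro bexI) auto
qed

text \<open>Of the eight patterns of \<open>p\<close>, \<open>q\<close>, \<open>s\<close> the
  conditions exclude exactly the two cyclic ones; the other six are the six orders of
  \<open>a\<close>, \<open>b\<close>, \<open>c\<close>.\<close>

lemma ranking_prescribed:
  assumes "finite A" "a \<in> A" "b \<in> A" "c \<in> A" "a \<noteq> b" "b \<noteq> c" "a \<noteq> c"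
    and pqs: "p \<and> q \<longrightarrow> s" "s \<longrightarrow> p \<or> q"
  shows "\<exists>r\<in>rankings A. ((a, b) \<in> r \<longleftrightarrow> p) \<and> ((b, c) \<in> r \<longleftrightarrow> q) \<and> ((a, c) \<in> r \<longleftrightarrow> s)"
proof -
  have *: "\<exists>r\<in>rankings A. ((a, b) \<in> r \<longleftrightarrow> p) \<and> ((b, c) \<in> r \<longleftrightarrow> q) \<and> ((a, c) \<in> r \<longleftrightarrow> s)"
    if "x \<in> A" "y \<in> A" "z \<in> A" "x \<noteq> y" "y \<noteq> z" "x \<noteq> z"
      "\<And>r. \<lbrakk>r \<in> rankings A; (x, y) \<in> r; (y, z) \<in> r; (x, z) \<in> r;
        (y, x) \<notin> r; (z, y) \<notin> r; (z, x) \<notin> r\<rbrakk>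
        \<Longrightarrow> ((a, b) \<in> r \<longleftrightarrow> p) \<and> ((b, c) \<in> r \<longleftrightarrow> q) \<and> ((a, c) \<in> r \<longleftrightarrow> s)"
    for x y z
    using ranking_extends[OF assms(1) that(1-6)] that(7) ranking_asym by metis
  consider "p" "q" "s" | "p" "\<not> q" "s" | "p" "\<not> q" "\<not> s"
    | "\<not> p" "q" "s" | "\<not> p" "q" "\<not> s" | "\<not> p" "\<not> q" "\<not> s"
    using pqs by blast
  then show ?thesis
  proof cases
    case 1 then show ?thesis using *[of a b c] assms by auto
  next
    case 2 then show ?thesis using *[of a c b] assms by auto
  next
    case 3 then show ?thesis using *[of c a b] assms by auto
  next
    case 4 then show ?thesis using *[of b a c] assms by auto
  next
    case 5 then show ?thesis using *[of b c a] assms by auto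
  next
    case 6 then show ?thesis using *[of c b a] assms by auto
  qed
qed

section \<open>Supporter sets and the Boolean function of a constitution\<close>

definition supporters :: "nat \<Rightarrow> (nat \<Rightarrow> 'a rel) \<Rightarrow> 'a \<Rightarrow> 'a \<Rightarrow> nat set" where
  "supporters n \<sigma> a b = {i \<in> {1..n}. (a, b) \<in> \<sigma> i}"

lemma supporters_swap:
  assumes "\<sigma> \<in> profiles n A" "a \<in> A" "b \<in> A" "a \<noteq> b"
  shows "supporters n \<sigma> b a = {1..n} - supporters n \<sigma> a b"
proof -
  have "\<sigma> i \<in> rankings A" if "i \<in> {1..n}" for i
    using assms(1) that by (auto simp: profiles_def)
  then have "(b, a) \<in> \<sigma> i \<longleftrightarrow> (a, b) \<notin> \<sigma> i" if "i \<in> {1..n}" for i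
    using ranking_total[of "\<sigma> i" A a b] assms(2-) that by blast
  then show ?thesis
    unfolding supporters_def by blast
qed

text \<open>Read for a single voter, the inclusions are the conditions of
  \<open>ranking_prescribed\<close>, so the rankings can be chosen voter by voter.\<close>

lemma profile_prescribed:
  assumes "finite A" "a \<in> A" "b \<in> A" "c \<in> A" "a \<noteq> b" "b \<noteq> c" "a \<noteq> c"
    and STU: "S \<subseteq> {1..n}" "T \<subseteq> {1..n}" "S \<inter> T \<subseteq> U" "U \<subseteq> S \<union> T"
  shows "\<exists>\<sigma>\<in>profiles n A.
    supporters n \<sigma> a b = S \<and> supporters n \<sigma> b c = T \<and> supporters n \<sigma> a c = U"
proof -
  have "\<exists>r\<in>rankings A. ((a, b) \<in> r \<longleftrightarrow> i \<in> S) \<and> ((b, c) \<in> r \<longleftrightarrow> i \<in> T) \<and> ((a, c) \<in> r \<longleftrightarrow> i \<in> U)"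
    for i
    using STU by (intro ranking_prescribed assms) auto
  then obtain \<sigma> where \<sigma>: "\<And>i. \<sigma> i \<in> rankings A" "\<And>i. (a, b) \<in> \<sigma> i \<longleftrightarrow> i \<in> S"
    "\<And>i. (b, c) \<in> \<sigma> i \<longleftrightarrow> i \<in> T" "\<And>i. (a, c) \<in> \<sigma> i \<longleftrightarrow> i \<in> U"
    by metis
  moreover have "U \<subseteq> {1..n}"
    using STU by blast
  \<comment> \<open>Profiles are extensional, hence the restriction to the voters.\<close>
  ultimately show ?thesis
    using STU by (intro bexI[of _ "restrict \<sigma> {1..n}"]) (auto simp: profiles_def supporters_def)
qed

text \<open>The choice of the witness profile is immaterial under IIA, so this is the Boolean
  function \<open>w\<close> of the abstract part.\<close>

definition wins :: "nat \<Rightarrow> 'a set \<Rightarrow> ((nat \<Rightarrow> 'a rel) \<Rightarrow> 'a rel) \<Rightarrow> 'a \<Rightarrow> 'a \<Rightarrow> nat set \<Rightarrow> bool" where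
  "wins n A F a b S \<longleftrightarrow> (\<exists>\<sigma>\<in>profiles n A. supporters n \<sigma> a b = S \<and> (a, b) \<in> F \<sigma>)"

lemma wins_supporters:
  assumes "IIA n A F" "\<sigma> \<in> profiles n A" "a \<in> A" "b \<in> A" "a \<noteq> b"
  shows "wins n A F a b (supporters n \<sigma> a b) \<longleftrightarrow> (a, b) \<in> F \<sigma>"
proof
  assume "wins n A F a b (supporters n \<sigma> a b)"
  then obtain \<tau> where \<tau>: "\<tau> \<in> profiles n A" "(a, b) \<in> F \<tau>"
    "supporters n \<tau> a b = supporters n \<sigma> a b"
    by (auto simp: wins_def)
  from \<tau>(3) have "\<forall>i\<in>{1..n}. (a, b) \<in> \<tau> i \<longleftrightarrow> (a, b) \<in> \<sigma> i"
    unfolding supporters_def by blast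
  then show "(a, b) \<in> F \<sigma>"
    using \<tau> assms unfolding IIA_def by blast
qed (use assms(2) in \<open>auto simp: wins_def\<close>)

lemma decisive_sets_wins:
  assumes A: "finite A" "card A \<ge> 3"
    and F: "constitution n A F" "transitivity n A F" "IIA n A F" "WNI n A F"
  shows "decisive_sets A {1..n} (wins n A F)"
proof
  show third: "\<exists>c\<in>A. c \<noteq> a \<and> c \<noteq> b" for a b
  proof (rule ccontr)
    assume "\<not> (\<exists>c\<in>A. c \<noteq> a \<and> c \<noteq> b)"
    then have "card A \<le> card {a, b}"
      by (intro card_mono) auto
    also have "\<dots> \<le> 2"
      by (simp add: card_insert_if)
    finally show False
      using A by simp
  qed
  fix a b assume ab: "a \<in> A" "b \<in> A" "a \<noteq> b"
  show "wins n A F b a ({1..n} - S) \<longleftrightarrow> \<not> wins n A F a b S" if S: "S \<subseteq> {1..n}" for S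
  proof -
    obtain c where "c \<in> A" "c \<noteq> a" "c \<noteq> b"
      using third by blast
    \<comment> \<open>Only the supporters of \<open>a\<close> over \<open>b\<close> matter; taking
      all three sets equal to \<open>S\<close> meets the inclusions.\<close>
    then obtain \<sigma> where \<sigma>: "\<sigma> \<in> profiles n A" "supporters n \<sigma> a b = S"
      using profile_prescribed[of A a b c S n S S] A ab S by auto
    then have "(b, a) \<in> F \<sigma> \<longleftrightarrow> (a, b) \<notin> F \<sigma>"
      using F(1) ab unfolding constitution_def by blast
    then show ?thesis
      using wins_supporters[OF F(3) \<sigma>(1), of a b] wins_supporters[OF F(3) \<sigma>(1), of b a]
        supporters_swap[OF \<sigma>(1) ab] \<sigma>(2) ab by auto
  qed
  show "\<exists>S\<subseteq>{1..n}. wins n A F a b S"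
  proof -
    obtain \<sigma> where "\<sigma> \<in> profiles n A" "(a, b) \<in> F \<sigma>"
      using F(4) ab unfolding WNI_def by blast
    then show ?thesis
      by (intro exI[of _ "supporters n \<sigma> a b"]) (auto simp: wins_def supporters_def)
  qed
next
  fix a b c S T U
  assume abc: "a \<in> A" "b \<in> A" "c \<in> A" "a \<noteq> b" "b \<noteq> c" "a \<noteq> c"
    and ST: "S \<subseteq> {1..n}" "T \<subseteq> {1..n}" "S \<inter> T \<subseteq> U" "U \<subseteq> S \<union> T"
    and w: "wins n A F a b S" "wins n A F b c T"
  \<comment> \<open>One profile realises all three sets, so Transitivity can be applied to
    it.\<close>
  obtain \<sigma> where \<sigma>: "\<sigma> \<in> profiles n A" "supporters n \<sigma> a b = S" "supporters n \<sigma> b c = T"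
    "supporters n \<sigma> a c = U"
    using profile_prescribed[OF A(1) abc ST] by auto
  note wins_iff = wins_supporters[OF F(3) \<sigma>(1)]
  have "(a, b) \<in> F \<sigma>" "(b, c) \<in> F \<sigma>"
    using wins_iff[of a b] wins_iff[of b c] w \<sigma> abc by auto
  then have "(a, c) \<in> F \<sigma>"
    using F(2) \<sigma>(1) abc unfolding transitivity_def by blast
  then show "wins n A F a c U"
    using wins_iff[of a c] \<sigma> abc by auto
qed simp

section \<open>From the winning voter sets back to the constitution\<close>

theorem theorem1p2:
  fixes A :: "'a set" and n :: nat and F :: "(nat \<Rightarrow> 'a rel) \<Rightarrow> 'a rel"
  assumes "finite A" and "card A \<ge> 3" and "n \<ge> 1"
    and "constitution n A F"
    and "transitivity n A F" and "IIA n A F" and "WNI n A F"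
  shows "\<exists>i\<in>{1..n}. (\<forall>\<sigma>\<in>profiles n A. F \<sigma> = \<sigma> i) \<or> (\<forall>\<sigma>\<in>profiles n A. F \<sigma> = (\<sigma> i)\<inverse>)"
proof -
  interpret decisive_sets A "{1..n}" "wins n A F"
    by (rule decisive_sets_wins) fact+
  obtain i where i: "i \<in> {1..n}" and dict:
    "(\<forall>a\<in>A. \<forall>b\<in>A. a \<noteq> b \<longrightarrow> (\<forall>S\<subseteq>{1..n}. wins n A F a b S \<longleftrightarrow> i \<in> S)) \<or>
     (\<forall>a\<in>A. \<forall>b\<in>A. a \<noteq> b \<longrightarrow> (\<forall>S\<subseteq>{1..n}. wins n A F a b S \<longleftrightarrow> i \<notin> S))"
    using dictator by blast
  have wins_iff: "wins n A F a b (supporters n \<sigma> a b) \<longleftrightarrow> (a, b) \<in> F \<sigma>"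
    and supp: "supporters n \<sigma> a b \<subseteq> {1..n}" "i \<in> supporters n \<sigma> a b \<longleftrightarrow> (a, b) \<in> \<sigma> i"
    if "\<sigma> \<in> profiles n A" "a \<in> A" "b \<in> A" "a \<noteq> b" for \<sigma> a b
    using wins_supporters[OF assms(6)] that i by (auto simp: supporters_def)
  \<comment> \<open>\<open>F \<sigma>\<close> and \<open>\<sigma> i\<close> both lie in
    \<open>A \<times> A\<close> off the diagonal, so agreement on distinct alternatives gives
    equality of relations.\<close>
  have F: "F \<sigma> \<subseteq> A \<times> A" "(a, a) \<notin> F \<sigma>" if "\<sigma> \<in> profiles n A" for \<sigma> a
    using assms(4) that by (auto simp: constitution_def irrefl_def)
  have r: "\<sigma> i \<in> rankings A" if "\<sigma> \<in> profiles n A" for \<sigma>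
    using that i by (auto simp: profiles_def)
  have s: "\<sigma> i \<subseteq> A \<times> A" "(a, a) \<notin> \<sigma> i" if "\<sigma> \<in> profiles n A" for \<sigma> a
    using r[OF that] by (auto simp: rankings_def strict_linear_order_on_def irrefl_def)
  from dict show ?thesis
  proof
    assume *: "\<forall>a\<in>A. \<forall>b\<in>A. a \<noteq> b \<longrightarrow> (\<forall>S\<subseteq>{1..n}. wins n A F a b S \<longleftrightarrow> i \<in> S)"
    have "(a, b) \<in> F \<sigma> \<longleftrightarrow> (a, b) \<in> \<sigma> i" if \<sigma>: "\<sigma> \<in> profiles n A" for \<sigma> a b
    proof (cases "a \<in> A \<and> b \<in> A \<and> a \<noteq> b")
      case True
      then show ?thesis
        using * wins_iff[OF \<sigma>, of a b] supp[OF \<sigma>, of a b] by blast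
    next
      case False
      then show ?thesis
        using F[OF \<sigma>] s[OF \<sigma>] by blast
    qed
    then have "F \<sigma> = \<sigma> i" if "\<sigma> \<in> profiles n A" for \<sigma>
      using that by auto
    then show ?thesis
      using i by blast
  next
    assume *: "\<forall>a\<in>A. \<forall>b\<in>A. a \<noteq> b \<longrightarrow> (\<forall>S\<subseteq>{1..n}. wins n A F a b S \<longleftrightarrow> i \<notin> S)"
    have "(a, b) \<in> F \<sigma> \<longleftrightarrow> (b, a) \<in> \<sigma> i" if \<sigma>: "\<sigma> \<in> profiles n A" for \<sigma> a b
    proof (cases "a \<in> A \<and> b \<in> A \<and> a \<noteq> b")
      case True
      then have "(a, b) \<in> F \<sigma> \<longleftrightarrow> (a, b) \<notin> \<sigma> i"
        using * wins_iff[OF \<sigma>, of a b] supp[OF \<sigma>, of a b] by blast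
      \<comment> \<open>Totality of the ranking turns "not above" into "below", which yields the
        converse relation.\<close>
      then show ?thesis
        using ranking_total[OF r[OF \<sigma>], of a b] True by blast
    next
      case False
      then show ?thesis
        using F[OF \<sigma>] s[OF \<sigma>] by blast
    qed
    then have "F \<sigma> = (\<sigma> i)\<inverse>" if "\<sigma> \<in> profiles n A" for \<sigma>
      using that by auto
    then show ?thesis
      using i by blast
  qed
qed

end
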